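(* Consider a planning query $(T=(V,E),w,v_s,V_g,h)$ with a resolution sequence, and run the algorithm IGHA* on it with any valid rule (a pair of SHIFT and ACTIVATE methods). Suppose that: (A1) the heuristic $h$ is admissible, i.e. $h(v)\le h^*(v)$ for all $v\in V$, where $h^*(v)$ is the lowest cost of a path in $T$ from $v$ to $V_g$ ($\infty$ if there is none); (A2) there is a finite $b$ such that every vertex of $T$ has at most $b$ children; (A3) there is $\epsilon>0$ such that $w(e)\ge\epsilon$ for all $e\in E$. If at some point of the run at least one solution (a path from $v_s$ to $V_g$) has been found, then IGHA* finds a best-cost path in $T=(V,E)$, i.e. a path from $v_s$ to a vertex of $V_g$ of minimum cost among all such paths in $T$, at or before termination.
   Context: **Planning query.** $T=(V,E)$ is a (possibly infinite) tree rooted at $v_s\in V$, given implicitly by a successor function $\mathrm{Succ}$ returning the set of children of a vertex; $w:E\to\mathbb R^+$ is an edge cost; $V_g\subseteq V$ is the goal set; $h:V\to\mathbb R_{\ge 0}$ is a heuristic. The cost $w(\pi)$ of a path is the sum of its edge costs, and $w(\emptyset)=\infty$. For a vertex $v$, $v.g$ is the cost of the tree path from $v_s$ to $v$ and $v.f=v.g+h(v)$. **Resolutions and dominance.** A sequence of resolutions $R_0,R_1,\dots$ is given; each resolution partitions the vertices into grid cells. $\hat v(v,R)$ denotes the vertex currently dominating (least $g$ so far) the cell of $v$ at resolution $R$; if the cell has no dominant vertex yet, $\hat v(v,R).g=\infty$. **Algorithm IGHA\*.** It keeps a collection $Q_v$ of vertices, each marked active or inactive; $Q_v.\mathrm{Active}$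 is the set of active vertices of $Q_v$, and PEEK/POP on it refer to a vertex with least $f$ (POP removes it from $Q_v$). Initialize $Q_v=\{v_s\}$ with $v_s$ active, $\hat\pi=\emptyset$, level $l=0$, $l'=0$. While $Q_v\ne\emptyset$, perform an *iteration* (numbered $0,1,2,\dots$): 1. Call ACTIVATE. 2. Forward search: while $Q_v.\mathrm{Active}\neq\emptyset$: let $u$ be the PEEK of $Q_v.\mathrm{Active}$. (i) If $u.f\ge w(\hat\pi)$, leave the loop. (ii) If $u\in V_g$, set $\hat\pi$ to the tree path from $v_s$ to $u$ (a solution is found) and leave the loop. (iii) Call SHIFT; if it signals a break, leave the loop. (iv) *Expand* $u$: POP $u$; for every $v\in\mathrm{Succ}(u)$, if $v.g<\hat v(v,R_l).g$ then mark $\hat v(v,R_l)$ inactive, set $\hat v(v,R_l)\gets v$ and mark $v$ active, otherwise mark $v$ inactive; in both cases insert $v$ into $Q_v$. 3. BOUND: remove from $Q_v$ every $v$ with $v.f\ge w(\hat\pi)$ (removing nothing if $\hat\pi=\emptyset$). 4. PROJECT: set $l\gets l'$ and recompute the dominant-vertex map $\hat v$ at the new resolution $R_l$. When $Q_v=\emptyset$, the algorithm terminates and returns $\hat\pi$. **Rules.** A SHIFT method chooses $l'$ (the resolution level of the next iteration) and may break the forward search only after the first iteration (iteration 0) and only once at least one vertex of $Q_v.\mathrm{Active}$ has been expanded in the current iteration. An ACTIVATE method sets the active/inactive status of the vertices in $Q_v$ in every iteration after the first. A *rule* is a pair of a SHIFT method and an ACTIVATE method. A rule is *valid* if $|Q_v.\mathrm{Active}|\ge1$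 before starting the forward search whenever $Q_v\ne\emptyset$. *)

theory Defs
  imports
    "Graph_Theory.Pair_Digraph"
    "HOL-Library.Extended_Real"
    "HOL-Library.Disjoint_Sets"
begin

section \<open>Planning queries\<close>

record 'v query =
  graph      :: "'v pair_pre_digraph"
  weight     :: "'v \<times> 'v \<Rightarrow> real"
  root       :: 'v
  goals      :: "'v set"
  heur       :: "'v \<Rightarrow> real"
  resolution :: "nat \<Rightarrow> 'v set set"

text \<open>Paths are lists of edges. The trivial path from a vertex to itself is \<open>[]\<close>; it has cost
  \<open>0\<close> and is not the ``absent path'' \<open>\<emptyset>\<close> of cost \<open>\<infinity>\<close>, which is modelled by \<open>None\<close> below.\<close>

definition path :: "'v query \<Rightarrow> 'v \<Rightarrow> ('v \<times> 'v) list \<Rightarrow> 'v \<Rightarrow> bool" where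
  "path P u p v \<longleftrightarrow> pre_digraph.awalk (with_proj (graph P)) u p v"

definition path_cost :: "'v query \<Rightarrow> ('v \<times> 'v) list \<Rightarrow> real" where
  "path_cost P p = sum_list (map (weight P) p)"

fun opt_cost :: "'v query \<Rightarrow> ('v \<times> 'v) list option \<Rightarrow> ereal" where
  "opt_cost P None = \<infinity>"
| "opt_cost P (Some p) = ereal (path_cost P p)"

definition children :: "'v query \<Rightarrow> 'v \<Rightarrow> 'v set" where
  "children P u = {v. (u, v) \<in> parcs (graph P)}"

definition rooted_tree :: "'v query \<Rightarrow> bool" where
  "rooted_tree P \<longleftrightarrow> pair_wf_digraph (graph P) \<and> root P \<in> pverts (graph P) \<and>
     (\<forall>v \<in> pverts (graph P). \<exists>!p. path P (root P) p v)"

definition planning_query :: "'v query \<Rightarrow> bool" where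
  "planning_query P \<longleftrightarrow> rooted_tree P \<and>
     (\<forall>e \<in> parcs (graph P). weight P e > 0) \<and>
     goals P \<subseteq> pverts (graph P) \<and>
     (\<forall>v \<in> pverts (graph P). heur P v \<ge> 0) \<and>
     (\<forall>i. partition_on (pverts (graph P)) (resolution P i))"

definition tree_path :: "'v query \<Rightarrow> 'v \<Rightarrow> ('v \<times> 'v) list" where
  "tree_path P v = (THE p. path P (root P) p v)"

definition g_value :: "'v query \<Rightarrow> 'v \<Rightarrow> real" where
  "g_value P v = path_cost P (tree_path P v)"

definition f_value :: "'v query \<Rightarrow> 'v \<Rightarrow> real" where
  "f_value P v = g_value P v + heur P v"

definition solution :: "'v query \<Rightarrow> ('v \<times> 'v) list \<Rightarrow> bool" where
  "solution P p \<longleftrightarrow> (\<exists>t \<in> goals P. path P (root P) p t)"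

definition best_solution :: "'v query \<Rightarrow> ('v \<times> 'v) list \<Rightarrow> bool" where
  "best_solution P p \<longleftrightarrow> solution P p \<and> (\<forall>q. solution P q \<longrightarrow> path_cost P p \<le> path_cost P q)"

text \<open>The infimum over the empty set is \<open>\<infinity>\<close>.\<close>

definition opt_heur :: "'v query \<Rightarrow> 'v \<Rightarrow> ereal" where
  "opt_heur P v = (INF p \<in> {p. \<exists>t \<in> goals P. path P v p t}. ereal (path_cost P p))"

definition admissible :: "'v query \<Rightarrow> bool" where
  "admissible P \<longleftrightarrow> (\<forall>v \<in> pverts (graph P). ereal (heur P v) \<le> opt_heur P v)"

definition bounded_branching :: "'v query \<Rightarrow> bool" where
  "bounded_branching P \<longleftrightarrow>
     (\<exists>b::nat. \<forall>v \<in> pverts (graph P). finite (children P v) \<and> card (children P v) \<le> b)"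

definition weights_bounded_below :: "'v query \<Rightarrow> bool" where
  "weights_bounded_below P \<longleftrightarrow> (\<exists>\<epsilon>>0. \<forall>e \<in> parcs (graph P). \<epsilon> \<le> weight P e)"


section \<open>States of IGHA*\<close>

datatype phase = Activation | Search | Bounding | Projection

text \<open>\<open>marked\<close> holds the vertices whose current mark is ``active''; it may contain vertices that
  have already left the queue. Every vertex enters the queue at most once, because its only parent
  is removed when it is expanded, so the queue is a set. \<open>generated\<close> collects all vertices inserted
  into the queue so far, and \<open>expansions\<close> counts the expansions in the current iteration.\<close>

record 'v igha_state =
  queue      :: "'v set"
  marked     :: "'v set"
  best       :: "('v \<times> 'v) list option"
  level      :: nat
  next_level :: nat
  dominant   :: "'v set \<Rightarrow> 'v option"
  generated  :: "'v set"
  iteration  :: nat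
  expansions :: nat
  phase      :: phase

definition active :: "'v igha_state \<Rightarrow> 'v set" where
  "active s = queue s \<inter> marked s"

definition cell :: "'v query \<Rightarrow> nat \<Rightarrow> 'v \<Rightarrow> 'v set" where
  "cell P i v = (THE C. C \<in> resolution P i \<and> v \<in> C)"

fun opt_g :: "'v query \<Rightarrow> 'v option \<Rightarrow> ereal" where
  "opt_g P None = \<infinity>"
| "opt_g P (Some v) = ereal (g_value P v)"

text \<open>\<open>D\<close> is a dominant-vertex map at level \<open>i\<close> when the vertices in \<open>G\<close> have been seen.\<close>

definition dominance_map :: "'v query \<Rightarrow> nat \<Rightarrow> 'v set \<Rightarrow> ('v set \<Rightarrow> 'v option) \<Rightarrow> bool" where
  "dominance_map P i G D \<longleftrightarrow>
     (\<forall>C \<in> resolution P i.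
        (G \<inter> C = {} \<longrightarrow> D C = None) \<and>
        (G \<inter> C \<noteq> {} \<longrightarrow>
           (\<exists>x \<in> G \<inter> C. D C = Some x \<and> (\<forall>y \<in> G \<inter> C. g_value P x \<le> g_value P y))))"

definition initial_state :: "'v query \<Rightarrow> 'v igha_state \<Rightarrow> bool" where
  "initial_state P s \<longleftrightarrow>
     queue s = {root P} \<and> marked s = {root P} \<and> best s = None \<and> level s = 0 \<and> next_level s = 0 \<and>
     generated s = {root P} \<and> dominance_map P 0 {root P} (dominant s) \<and>
     iteration s = 0 \<and> expansions s = 0 \<and> phase s = Activation"

definition terminated :: "'v igha_state \<Rightarrow> bool" where
  "terminated s \<longleftrightarrow> phase s = Activation \<and> queue s = {}"

definition peek :: "'v query \<Rightarrow> 'v igha_state \<Rightarrow> 'v \<Rightarrow> bool" where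
  "peek P s u \<longleftrightarrow> u \<in> active s \<and> (\<forall>x \<in> active s. f_value P u \<le> f_value P x)"

definition pop :: "'v \<Rightarrow> 'v igha_state \<Rightarrow> 'v igha_state" where
  "pop u s = s\<lparr>queue := queue s - {u}, expansions := Suc (expansions s)\<rparr>"

definition insert_child :: "'v query \<Rightarrow> 'v \<Rightarrow> 'v igha_state \<Rightarrow> 'v igha_state" where
  "insert_child P v s =
     (let C = cell P (level s) v; d = dominant s C in
      if ereal (g_value P v) < opt_g P d
      then s\<lparr>marked := insert v (marked s - set_option d), dominant := (dominant s)(C := Some v),
             queue := insert v (queue s), generated := insert v (generated s)\<rparr>
      else s\<lparr>marked := marked s - {v},
             queue := insert v (queue s), generated := insert v (generated s)\<rparr>)"


section \<open>Rules\<close>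

text \<open>A history is the nonempty list of all states of a run so far, oldest first. Since methods
  may consult the whole history, they can maintain an internal state; a randomised method is
  covered by treating every outcome of its random choices as a separate method. SHIFT also sees
  the vertex returned by PEEK; it returns whether to break, and the new \<open>l'\<close>. ACTIVATE returns
  the vertices of the queue that become active, the others becoming inactive.\<close>

type_synonym 'v shift = "'v igha_state list \<Rightarrow> 'v \<Rightarrow> bool \<times> nat"
type_synonym 'v activate = "'v igha_state list \<Rightarrow> 'v set"
type_synonym 'v rule = "'v shift \<times> 'v activate"

definition shift_method :: "'v shift \<Rightarrow> bool" where
  "shift_method S \<longleftrightarrow>
     (\<forall>hs u. hs \<noteq> [] \<longrightarrow> fst (S hs u) \<longrightarrow> iteration (last hs) > 0 \<and> expansions (last hs) > 0)"


section \<open>Runs\<close>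

text \<open>\<open>igha_step P \<rho> hs s s'\<close>: the run with history \<open>hs\<close>, whose last state is \<open>s\<close>, may continue
  with \<open>s'\<close>. The order of the children and the choices between vertices of equal \<open>f\<close> in PEEK or
  equal \<open>g\<close> in PROJECT are left open.\<close>

inductive igha_step ::
    "'v query \<Rightarrow> 'v rule \<Rightarrow> 'v igha_state list \<Rightarrow> 'v igha_state \<Rightarrow> 'v igha_state \<Rightarrow> bool"
  for P :: "'v query" and \<rho> :: "'v rule" and hs :: "'v igha_state list" and s :: "'v igha_state"
where
  activate_first:
    "\<lbrakk>phase s = Activation; queue s \<noteq> {}; iteration s = 0\<rbrakk>
     \<Longrightarrow> igha_step P \<rho> hs s (s\<lparr>phase := Search\<rparr>)"
| activate_later:
    "\<lbrakk>phase s = Activation; queue s \<noteq> {}; iteration s > 0\<rbrakk>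
     \<Longrightarrow> igha_step P \<rho> hs s (s\<lparr>marked := queue s \<inter> snd \<rho> hs, phase := Search\<rparr>)"
| search_exhausted:
    "\<lbrakk>phase s = Search; active s = {}\<rbrakk>
     \<Longrightarrow> igha_step P \<rho> hs s (s\<lparr>phase := Bounding\<rparr>)"
| search_bound:
    "\<lbrakk>phase s = Search; peek P s u; ereal (f_value P u) \<ge> opt_cost P (best s)\<rbrakk>
     \<Longrightarrow> igha_step P \<rho> hs s (s\<lparr>phase := Bounding\<rparr>)"
| search_goal:
    "\<lbrakk>phase s = Search; peek P s u; ereal (f_value P u) < opt_cost P (best s); u \<in> goals P\<rbrakk>
     \<Longrightarrow> igha_step P \<rho> hs s (s\<lparr>best := Some (tree_path P u), phase := Bounding\<rparr>)"
| search_break: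
    "\<lbrakk>phase s = Search; peek P s u; ereal (f_value P u) < opt_cost P (best s); u \<notin> goals P;
      fst \<rho> hs u = (True, l')\<rbrakk>
     \<Longrightarrow> igha_step P \<rho> hs s (s\<lparr>next_level := l', phase := Bounding\<rparr>)"
| search_expand:
    "\<lbrakk>phase s = Search; peek P s u; ereal (f_value P u) < opt_cost P (best s); u \<notin> goals P;
      fst \<rho> hs u = (False, l'); distinct vs; set vs = children P u\<rbrakk>
     \<Longrightarrow> igha_step P \<rho> hs s (fold (insert_child P) vs (pop u (s\<lparr>next_level := l'\<rparr>)))"
| bound:
    "phase s = Bounding
     \<Longrightarrow> igha_step P \<rho> hs s
           (s\<lparr>queue := queue s - {v. ereal (f_value P v) \<ge> opt_cost P (best s)},
              phase := Projection\<rparr>)"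
| project:
    "\<lbrakk>phase s = Projection; dominance_map P (next_level s) (generated s) D\<rbrakk>
     \<Longrightarrow> igha_step P \<rho> hs s
           (s\<lparr>level := next_level s, dominant := D, iteration := Suc (iteration s),
              expansions := 0, phase := Activation\<rparr>)"

inductive history :: "'v query \<Rightarrow> 'v rule \<Rightarrow> 'v igha_state list \<Rightarrow> bool"
  for P :: "'v query" and \<rho> :: "'v rule"
where
  history_init: "initial_state P s \<Longrightarrow> history P \<rho> [s]"
| history_step: "\<lbrakk>history P \<rho> hs; igha_step P \<rho> hs (last hs) s'\<rbrakk> \<Longrightarrow> history P \<rho> (hs @ [s'])"

definition valid_rule :: "'v query \<Rightarrow> 'v rule \<Rightarrow> bool" where
  "valid_rule P \<rho> \<longleftrightarrow> shift_method (fst \<rho>) \<and>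
     (\<forall>hs s'. history P \<rho> hs \<longrightarrow> phase (last hs) = Activation \<longrightarrow>
        igha_step P \<rho> hs (last hs) s' \<longrightarrow> queue s' \<noteq> {} \<longrightarrow> active s' \<noteq> {})"

text \<open>A complete run; a terminated run is continued by repeating its final state forever.\<close>

definition igha_run :: "'v query \<Rightarrow> 'v rule \<Rightarrow> (nat \<Rightarrow> 'v igha_state) \<Rightarrow> bool" where
  "igha_run P \<rho> \<sigma> \<longleftrightarrow> initial_state P (\<sigma> 0) \<and>
     (\<forall>n. if terminated (\<sigma> n) then \<sigma> (Suc n) = \<sigma> n
          else igha_step P \<rho> (map \<sigma> [0..<Suc n]) (\<sigma> n) (\<sigma> (Suc n)))"

end

(* Until the incumbent is at least as cheap as a goal vertex t, some vertex of the tree path to t stays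
   in the queue: expanding a vertex passes this role to a child, and by admissibility BOUND removes
   only vertices none of whose descendants improves on the incumbent. So the incumbent is optimal
   once the queue is empty.

   Once there is an incumbent of cost c, only vertices with g < c are expanded; these are finitely
   many by (A2) and (A3), and each is expanded at most once because its parent has left the queue for
   good. An iteration without an expansion can only end at a vertex u with f(u) at least the cost of
   the (possibly new) incumbent, and BOUND then removes u. Hence the finite queue runs empty. *)

theory Submission
  imports Defs
begin

section \<open>Paths in the tree\<close>

lemma path_Nil_iff:
  assumes "pair_wf_digraph (graph P)"
  shows "path P u [] v \<longleftrightarrow> u = v \<and> u \<in> pverts (graph P)"
proof -
  interpret pair_wf_digraph "graph P" by fact
  show ?thesis unfolding path_def by (auto simp: awalk_Nil_iff)
qed

lemma path_Cons_iff:
  assumes "pair_wf_digraph (graph P)"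
  shows "path P u (e # p) v \<longleftrightarrow> e \<in> parcs (graph P) \<and> fst e = u \<and> path P (snd e) p v"
proof -
  interpret pair_wf_digraph "graph P" by fact
  show ?thesis unfolding path_def by (auto simp: awalk_Cons_iff)
qed

lemma path_append_iff:
  assumes "pair_wf_digraph (graph P)"
  shows "path P u (p @ q) v \<longleftrightarrow> (\<exists>x. path P u p x \<and> path P x q v)"
proof (induction p arbitrary: u)
  case Nil
  have "path P u q v \<Longrightarrow> u \<in> pverts (graph P)"
    by (auto simp: path_def pre_digraph.awalk_def)
  then show ?case using path_Nil_iff[OF assms] by auto
qed (auto simp: path_Cons_iff[OF assms])

lemma path_verts: "path P u p v \<Longrightarrow> u \<in> pverts (graph P)"
  "pair_wf_digraph (graph P) \<Longrightarrow> path P u p v \<Longrightarrow> v \<in> pverts (graph P)"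
proof -
  show "path P u p v \<Longrightarrow> u \<in> pverts (graph P)"
    by (auto simp: path_def pre_digraph.awalk_def)
  show "pair_wf_digraph (graph P) \<Longrightarrow> path P u p v \<Longrightarrow> v \<in> pverts (graph P)"
    by (induction p arbitrary: u) (auto simp: path_Nil_iff path_Cons_iff)
qed

lemma path_cost_append: "path_cost P (p @ q) = path_cost P p + path_cost P q"
  by (simp add: path_cost_def)

text \<open>Induction over levels: the last edge of a path of length \<open>Suc k\<close> leads to a
  child of an end vertex on level \<open>k\<close>.\<close>

lemma finite_paths_of_length:
  assumes "pair_wf_digraph (graph P)" and "\<And>v. v \<in> pverts (graph P) \<Longrightarrow> finite (children P v)"
  shows "finite {v. \<exists>p. path P u p v \<and> length p = k}"
proof (induction k)
  case 0
  have "{v. \<exists>p. path P u p v \<and> length p = 0} \<subseteq> {u}"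
    by (auto simp: path_Nil_iff[OF assms(1)])
  then show ?case by (rule finite_subset) simp
next
  case (Suc k)
  let ?L = "{v. \<exists>p. path P u p v \<and> length p = k}"
  have "{v. \<exists>p. path P u p v \<and> length p = Suc k} \<subseteq> (\<Union>x\<in>?L. children P x)"
  proof clarify
    fix v p assume p: "path P u p v" "length p = Suc k"
    then obtain q e where q: "p = q @ [e]" "length q = k"
      by (metis length_Suc_conv_rev)
    with p obtain x where x: "path P u q x" "path P x [e] v"
      by (auto simp: path_append_iff[OF assms(1)])
    then have "v \<in> children P x"
      by (cases e) (auto simp: children_def path_Cons_iff[OF assms(1)] path_Nil_iff[OF assms(1)])
    with x q show "v \<in> (\<Union>x\<in>?L. children P x)" by auto
  qed
  moreover have "finite (\<Union>x\<in>?L. children P x)"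
    using Suc assms(2) path_verts(2)[OF assms(1)] by blast
  ultimately show ?case by (rule finite_subset)
qed

section \<open>Uniqueness of tree paths and its consequences for costs\<close>

locale planning =
  fixes P :: "'v query"
  assumes planning: "planning_query P"
begin

lemma wf_graph: "pair_wf_digraph (graph P)"
  using planning by (simp add: planning_query_def rooted_tree_def)

lemmas path_Nil = path_Nil_iff[OF wf_graph]
  and path_Cons = path_Cons_iff[OF wf_graph]
  and path_append = path_append_iff[OF wf_graph]
  and path_end = path_verts(2)[OF wf_graph]

lemma tree_path_eqI:
  assumes "path P (root P) p v"
  shows "tree_path P v = p"
proof -
  have "\<exists>!p. path P (root P) p v"
    using planning path_end[OF assms] by (simp add: planning_query_def rooted_tree_def)
  then show ?thesis unfolding tree_path_def using assms by (rule the1_equality)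
qed

lemma path_tree_path:
  assumes "v \<in> pverts (graph P)"
  shows "path P (root P) (tree_path P v) v"
proof -
  obtain p where "path P (root P) p v"
    using planning assms unfolding planning_query_def rooted_tree_def by blast
  then show ?thesis using tree_path_eqI by simp
qed

lemma root_vertex: "root P \<in> pverts (graph P)"
  using planning by (simp add: planning_query_def rooted_tree_def)

lemma goal_vertex: "t \<in> goals P \<Longrightarrow> t \<in> pverts (graph P)"
  using planning by (auto simp: planning_query_def)

lemma children_vertex: "v \<in> children P u \<Longrightarrow> u \<in> pverts (graph P) \<and> v \<in> pverts (graph P)"
  using wf_graph by (auto simp: children_def pair_wf_digraph_def)

lemma g_le_f: "v \<in> pverts (graph P) \<Longrightarrow> g_value P v \<le> f_value P v"
  using planning by (simp add: planning_query_def f_value_def)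

text \<open>Follows from uniqueness of root paths. The next three lemmas compare such edge lists to
  read off their tree properties.\<close>

lemma tree_path_child:
  assumes "v \<in> children P u"
  shows "tree_path P v = tree_path P u @ [(u, v)]"
  using assms path_tree_path[of u] children_vertex[OF assms]
  by (intro tree_path_eqI) (auto simp: path_append path_Cons path_Nil children_def)

lemma parent_unique:
  assumes "v \<in> children P u" "v \<in> children P u'"
  shows "u = u'"
  using tree_path_child[OF assms(1)] tree_path_child[OF assms(2)] by simp

lemma not_child_of_itself: "u \<notin> children P u"
  using tree_path_child[of u u] by auto

lemma root_not_child: "root P \<notin> children P u"
  using tree_path_child[of "root P" u] tree_path_eqI[of "[]" "root P"] root_vertex
  by (auto simp: path_Nil)

lemma g_value_path:
  assumes "path P v p t"
  shows "g_value P t = g_value P v + path_cost P p"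
proof -
  have "tree_path P t = tree_path P v @ p"
    using assms path_tree_path[OF path_verts(1)[OF assms]]
    by (intro tree_path_eqI) (auto simp: path_append)
  then show ?thesis by (simp add: g_value_def path_cost_append)
qed

text \<open>\<open>p\<close> is a candidate in the infimum \<open>opt_heur\<close> and prolongs the
  tree path of \<open>v\<close>. This makes the removals of BOUND safe.\<close>

lemma f_value_le_goal:
  assumes "admissible P" "path P v p t" "t \<in> goals P"
  shows "f_value P v \<le> g_value P t"
proof -
  have "ereal (heur P v) \<le> opt_heur P v"
    using assms(1) path_verts(1)[OF assms(2)] by (auto simp: admissible_def)
  also have "\<dots> \<le> ereal (path_cost P p)"
    unfolding opt_heur_def using assms(2,3) by (intro INF_lower) auto
  finally show ?thesis by (simp add: f_value_def g_value_path[OF assms(2)])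
qed

text \<open>Edges cost at least \<epsilon>, so a tree path cheaper than \<open>c\<close> has fewer
  than \<open>c / \<epsilon>\<close> edges; finitely many levels remain, each finite.\<close>

lemma finite_cheap_vertices:
  assumes "bounded_branching P" "weights_bounded_below P"
  shows "finite {v \<in> pverts (graph P). g_value P v < c}"
proof -
  obtain \<epsilon> where \<epsilon>: "\<epsilon> > 0" "\<And>e. e \<in> parcs (graph P) \<Longrightarrow> \<epsilon> \<le> weight P e"
    using assms(2) by (auto simp: weights_bounded_below_def)
  have cost: "\<epsilon> * real (length p) \<le> path_cost P p" if "path P u p v" for u p v
    using that
  proof (induction p arbitrary: u)
    case (Cons e p)
    then show ?case using \<epsilon>(2)[of e] by (fastforce simp: path_Cons path_cost_def algebra_simps)
  qed (simp add: path_cost_def)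
  have "{v \<in> pverts (graph P). g_value P v < c} \<subseteq>
      (\<Union>k\<le>nat \<lceil>c / \<epsilon>\<rceil>. {v. \<exists>p. path P (root P) p v \<and> length p = k})"
  proof clarify
    fix v assume v: "v \<in> pverts (graph P)" "g_value P v < c"
    have "\<epsilon> * real (length (tree_path P v)) < c"
      using cost[OF path_tree_path[OF v(1)]] v(2) by (simp add: g_value_def)
    then have "real (length (tree_path P v)) < c / \<epsilon>"
      using \<epsilon>(1) by (simp add: field_simps)
    then have "length (tree_path P v) \<le> nat \<lceil>c / \<epsilon>\<rceil>"
      by linarith
    then show "v \<in> (\<Union>k\<le>nat \<lceil>c / \<epsilon>\<rceil>. {v. \<exists>p. path P (root P) p v \<and> length p = k})"
      using path_tree_path[OF v(1)] by blast
  qed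
  moreover have "finite (\<Union>k\<le>nat \<lceil>c / \<epsilon>\<rceil>. {v. \<exists>p. path P (root P) p v \<and> length p = k})"
    using assms(1) by (auto simp: bounded_branching_def intro!: finite_paths_of_length[OF wf_graph])
  ultimately show ?thesis by (rule finite_subset)
qed

end


section \<open>Invariants of a run\<close>

text \<open>Both outcomes of the dominance test insert the child, so these fields do not depend on
  marks or dominant vertices.\<close>

lemma insert_child_simps [simp]:
  "queue (insert_child P v s) = insert v (queue s)"
  "generated (insert_child P v s) = insert v (generated s)"
  "best (insert_child P v s) = best s"
  "phase (insert_child P v s) = phase s"
  "expansions (insert_child P v s) = expansions s"
  by (simp_all add: insert_child_def Let_def)

lemma fold_insert_child_simps [simp]:
  "queue (fold (insert_child P) vs s) = set vs \<union> queue s"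
  "generated (fold (insert_child P) vs s) = set vs \<union> generated s"
  "best (fold (insert_child P) vs s) = best s"
  "phase (fold (insert_child P) vs s) = phase s"
  "expansions (fold (insert_child P) vs s) = expansions s"
proof -
  show "queue (fold (insert_child P) vs s) = set vs \<union> queue s"
    by (induction vs arbitrary: s) simp_all
  show "generated (fold (insert_child P) vs s) = set vs \<union> generated s"
    by (induction vs arbitrary: s) simp_all
  show "best (fold (insert_child P) vs s) = best s"
    by (induction vs arbitrary: s) simp_all
  show "phase (fold (insert_child P) vs s) = phase s"
    by (induction vs arbitrary: s) simp_all
  show "expansions (fold (insert_child P) vs s) = expansions s"
    by (induction vs arbitrary: s) simp_all
qed

lemma pop_simps [simp]:
  "queue (pop u s) = queue s - {u}"
  "generated (pop u s) = generated s"
  "best (pop u s) = best s"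
  "phase (pop u s) = phase s"
  "expansions (pop u s) = Suc (expansions s)"
  by (simp_all add: pop_def)

text \<open>The last conjunct excludes re-insertion: a vertex still in the queue has no generated
  child, so expanding it inserts only new vertices.\<close>

definition queue_invariant :: "'v query \<Rightarrow> 'v igha_state \<Rightarrow> bool" where
  "queue_invariant P s \<longleftrightarrow>
     finite (queue s) \<and> queue s \<subseteq> generated s \<and> generated s \<subseteq> pverts (graph P) \<and>
     (\<forall>x. \<forall>y \<in> children P x \<inter> generated s. x \<in> generated s - queue s)"

text \<open>A path from \<open>v\<close> to \<open>t\<close> places \<open>v\<close> on the tree
  path to \<open>t\<close>. Without an incumbent the cost is \<infinity>, so the second alternative
  must hold.\<close>

definition coverage_invariant :: "'v query \<Rightarrow> 'v igha_state \<Rightarrow> bool" where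
  "coverage_invariant P s \<longleftrightarrow>
     (\<forall>p. best s = Some p \<longrightarrow> solution P p) \<and>
     (\<forall>t \<in> goals P. opt_cost P (best s) \<le> ereal (g_value P t) \<or>
        (\<exists>v \<in> queue s. \<exists>p. path P v p t))"

text \<open>As long as an iteration has expanded nothing, its search cannot be exhausted, and BOUND
  will find a vertex to remove.\<close>

definition progress_invariant :: "'v query \<Rightarrow> 'v igha_state \<Rightarrow> bool" where
  "progress_invariant P s \<longleftrightarrow> expansions s = 0 \<longrightarrow>
     (phase s = Search \<longrightarrow> active s \<noteq> {}) \<and>
     (phase s = Bounding \<longrightarrow> (\<exists>v \<in> queue s. opt_cost P (best s) \<le> ereal (f_value P v)))"

lemma peek_queue: "peek P s u \<Longrightarrow> u \<in> queue s"
  by (simp add: peek_def active_def)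

section \<open>Preservation of the invariants\<close>

context planning
begin

lemma queue_invariant_initial:
  assumes "initial_state P s"
  shows "queue_invariant P s"
  using assms root_vertex root_not_child by (auto simp: queue_invariant_def initial_state_def)

lemma queue_invariant_step:
  assumes "queue_invariant P s" "igha_step P \<rho> hs s s'"
  shows "queue_invariant P s'"
  using assms(2)
proof cases
  case (search_expand u l' vs)
  have u: "u \<in> queue s" using peek_queue[OF search_expand(3)] .
  note inv = assms(1)[unfolded queue_invariant_def]
  have "x \<in> generated s' - queue s'" if y: "y \<in> children P x \<inter> generated s'" for x y
  proof (cases "y \<in> generated s")
    case True
    then have x: "x \<in> generated s - queue s" using y inv by blast
    \<comment> \<open>Otherwise \<open>x\<close> would be a generated child of \<open>u\<close>,
      forcing \<open>u\<close> out of the queue.\<close>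
    then have "x \<notin> children P u" using inv u by blast
    with x show ?thesis using search_expand by simp
  next
    case False
    \<comment> \<open>\<open>y\<close> is new, hence a child of \<open>u\<close>, which has just
      been popped and is not its own child.\<close>
    then have "x = u" using y search_expand parent_unique[of y x u] by simp
    then show ?thesis using search_expand u inv not_child_of_itself by auto
  qed
  \<comment> \<open>Finiteness comes from the list \<open>vs\<close> enumerating the
    children.\<close>
  moreover have "finite (children P u)"
    using search_expand by (metis finite_set)
  then have "queue s' \<subseteq> generated s'" "generated s' \<subseteq> pverts (graph P)" "finite (queue s')"
    using search_expand inv children_vertex by auto
  ultimately show ?thesis unfolding queue_invariant_def by blast
qed (use assms(1) in \<open>auto simp: queue_invariant_def\<close>)

lemma coverage_invariant_initial:
  assumes "initial_state P s"
  shows "coverage_invariant P s"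
  using assms path_tree_path goal_vertex by (force simp: coverage_invariant_def initial_state_def)

lemma coverage_invariant_step:
  assumes "admissible P" "queue_invariant P s" "coverage_invariant P s" "igha_step P \<rho> hs s s'"
  shows "coverage_invariant P s'"
  using assms(4)
proof cases
  case (search_goal u)
  have u: "u \<in> pverts (graph P)" using search_goal goal_vertex by blast
  have "ereal (g_value P u) \<le> ereal (f_value P u)" using g_le_f[OF u] by simp
  also have "\<dots> \<le> opt_cost P (best s)" using search_goal by simp
  finally have "opt_cost P (best s') \<le> opt_cost P (best s)"
    using search_goal by (simp add: g_value_def)
  then have "opt_cost P (best s') \<le> ereal (g_value P t) \<or> (\<exists>v \<in> queue s'. \<exists>p. path P v p t)"
    if "t \<in> goals P" for t
    using that assms(3) search_goal(1) unfolding coverage_invariant_def by (auto dest: order_trans)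
  moreover have "solution P (tree_path P u)"
    using search_goal path_tree_path[OF u] by (auto simp: solution_def)
  ultimately show ?thesis using search_goal(1) by (simp add: coverage_invariant_def)
next
  case (search_expand u l' vs)
  have "\<exists>v \<in> queue s'. \<exists>p. path P v p t"
    if t: "t \<in> goals P" "v \<in> queue s" "path P v p t" for v p t
  proof (cases "v = u")
    case True
    \<comment> \<open>\<open>u\<close> is not a goal, so \<open>p\<close> is nonempty; its first
      edge leads to the child that replaces \<open>u\<close> as witness.\<close>
    then obtain e q where "p = e # q"
      using t search_expand by (cases p) (auto simp: path_Nil)
    with t True have "snd e \<in> children P u" "path P (snd e) q t"
      by (auto simp: path_Cons children_def)
    then show ?thesis using search_expand by auto
  next
    case False
    with t show ?thesis using search_expand by auto
  qed
  moreover have "best s' = best s" using search_expand by simp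
  ultimately show ?thesis using assms(3) unfolding coverage_invariant_def by metis
next
  case bound
  \<comment> \<open>If BOUND drops \<open>v\<close>, the incumbent costs at most
    \<open>f_value P v\<close>, which by admissibility is at most
    \<open>g_value P t\<close>.\<close>
  have "opt_cost P (best s) \<le> ereal (g_value P t) \<or> v \<in> queue s'"
    if "t \<in> goals P" "v \<in> queue s" "path P v p t" for v p t
  proof -
    have "ereal (f_value P v) \<le> ereal (g_value P t)"
      using f_value_le_goal[OF assms(1) that(3,1)] by simp
    then show ?thesis using that bound by (auto intro: order_trans)
  qed
  moreover have "best s' = best s" using bound by simp
  ultimately show ?thesis using assms(3) unfolding coverage_invariant_def by metis
qed (use assms(3) in \<open>auto simp: coverage_invariant_def\<close>)

text \<open>Without an expansion, validity excludes an exhausted search and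
  \<open>shift_method\<close> excludes a break; the other two exits leave the peeked vertex in the
  queue as witness.\<close>

lemma progress_invariant_step:
  assumes "valid_rule P \<rho>" "history P \<rho> hs" "queue_invariant P (last hs)"
    and "progress_invariant P (last hs)" "igha_step P \<rho> hs (last hs) s'"
  shows "progress_invariant P s'"
proof -
  have hs: "hs \<noteq> []" using assms(2) by (cases) auto
  have valid: "phase (last hs) = Activation \<Longrightarrow> queue s' \<noteq> {} \<Longrightarrow> active s' \<noteq> {}"
    using assms(1,2,5) unfolding valid_rule_def by blast
  have shift: "fst (fst \<rho> hs u) \<Longrightarrow> expansions (last hs) > 0" for u
    using assms(1) hs unfolding valid_rule_def shift_method_def by blast
  from assms(5) show ?thesis
  proof cases
    case (search_bound u)
    then show ?thesis using peek_queue by (fastforce simp: progress_invariant_def)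
  next
    case (search_goal u)
    \<comment> \<open>The goal is not popped, and the new incumbent costs
      \<open>g_value P u\<close>, so BOUND will discard \<open>u\<close> itself.\<close>
    then have "u \<in> queue s'" "opt_cost P (best s') \<le> ereal (f_value P u)"
      using peek_queue g_le_f[OF goal_vertex] by (auto simp: g_value_def)
    then show ?thesis using search_goal by (auto simp: progress_invariant_def)
  next
    case (search_break u l')
    then show ?thesis using shift[of u] by (simp add: progress_invariant_def)
  qed (use assms(4) valid in \<open>auto simp: progress_invariant_def\<close>)
qed

end


section \<open>Termination\<close>

text \<open>Lexicographically decreasing: an expansion lowers the first component, and PROJECT after an
  iteration with an expansion lowers the second. If nothing was expanded, BOUND removes a vertex;
  the \<open>4\<close> of the phase Projection keeps in reserve the return to Activation.\<close>

definition remaining_work :: "'v set \<Rightarrow> 'v igha_state \<Rightarrow> nat \<times> nat \<times> nat" where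
  "remaining_work F s =
     (card (F - (generated s - queue s)),
      if expansions s = 0 then 0 else 1,
      (if expansions s = 0 then 4 * card (queue s) else 0) +
      (case phase s of Activation \<Rightarrow> 3 | Search \<Rightarrow> 2 | Bounding \<Rightarrow> 1
       | Projection \<Rightarrow> if expansions s = 0 then 4 else 0))"

text \<open>The incumbent changes only at a goal whose \<open>f_value\<close>, and so its
  \<open>g_value\<close>, is below the old cost. Hence a cost bound persists along the run.\<close>

lemma best_cost_step:
  assumes "planning_query P" "igha_step P \<rho> hs s s'"
  shows "opt_cost P (best s') \<le> opt_cost P (best s)"
proof -
  interpret planning P by standard fact
  from assms(2) show ?thesis
  proof cases
    case (search_goal u)
    have "ereal (g_value P u) \<le> ereal (f_value P u)"
      using search_goal g_le_f[OF goal_vertex] by simp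
    also have "\<dots> \<le> opt_cost P (best s)" using search_goal by simp
    finally show ?thesis using search_goal by (simp add: g_value_def)
  qed auto
qed

text \<open>Any expanded vertex has \<open>f_value\<close> below \<open>c\<close>, so it lies in
  \<open>F\<close> and, once popped, no longer counts in the first component.\<close>

lemma (in planning) remaining_work_step:
  assumes "queue_invariant P s" "progress_invariant P s" "igha_step P \<rho> hs s s'"
    and "opt_cost P (best s) \<le> ereal c"
    and F: "F = {v \<in> pverts (graph P). g_value P v < c}" "finite F"
  shows "(remaining_work F s', remaining_work F s) \<in> less_than <*lex*> less_than <*lex*> less_than"
  using assms(3)
proof cases
  case (search_expand u l' vs)
  note inv = assms(1)[unfolded queue_invariant_def]
  have u: "u \<in> queue s" using peek_queue[OF search_expand(3)] .
  then have "u \<in> pverts (graph P)" using inv by blast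
  moreover have "f_value P u < c"
    using search_expand(4) assms(4) by (metis less_le_trans less_ereal.simps(1))
  ultimately have "u \<in> F" using F(1) g_le_f[of u] by auto
  moreover have "generated s - queue s \<subseteq> generated s' - queue s'"
    using search_expand inv u by auto
  moreover have "u \<in> generated s' - queue s'"
    using search_expand inv u not_child_of_itself by auto
  ultimately have "F - (generated s' - queue s') \<subset> F - (generated s - queue s)"
    using u by blast
  then have "card (F - (generated s' - queue s')) < card (F - (generated s - queue s))"
    using F(2) by (intro psubset_card_mono) auto
  then show ?thesis by (simp add: remaining_work_def)
next
  case bound
  \<comment> \<open>BOUND also takes vertices out of the queue, so the first component may drop but
    never grows.\<close>
  have le: "card (F - (generated s' - queue s')) \<le> card (F - (generated s - queue s))"
    using F(2) bound by (intro card_mono) auto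
  show ?thesis
  proof (cases "expansions s = 0")
    case True
    \<comment> \<open>The witness of \<open>progress_invariant\<close> is removed. This lowers
      \<open>4 * card (queue s)\<close> by at least \<open>4\<close>, while the phase term rises
      only from \<open>1\<close> to \<open>4\<close>.\<close>
    then have "queue s' \<subset> queue s"
      using assms(2) bound by (auto simp: progress_invariant_def)
    then have "card (queue s') < card (queue s)"
      using assms(1) by (intro psubset_card_mono) (auto simp: queue_invariant_def)
    then show ?thesis using le True bound by (auto simp: remaining_work_def)
  next
    case False
    then show ?thesis using le bound by (auto simp: remaining_work_def)
  qed
qed (simp_all add: remaining_work_def)

theorem mainTheorem2:
  fixes P :: "'v query" and \<rho> :: "'v rule" and \<sigma> :: "nat \<Rightarrow> 'v igha_state"
  assumes "planning_query P"
    and "valid_rule P \<rho>"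
    and "igha_run P \<rho> \<sigma>"
    and "admissible P"
    and "bounded_branching P"
    and "weights_bounded_below P"
    and "\<exists>n p. best (\<sigma> n) = Some p"
  shows "\<exists>N. terminated (\<sigma> N) \<and> (\<exists>m\<le>N. \<exists>p. best (\<sigma> m) = Some p \<and> best_solution P p)"
proof -
  interpret planning P by standard fact
  have init: "initial_state P (\<sigma> 0)"
    and stay: "terminated (\<sigma> n) \<Longrightarrow> \<sigma> (Suc n) = \<sigma> n"
    and step: "\<not> terminated (\<sigma> n) \<Longrightarrow> igha_step P \<rho> (map \<sigma> [0..<Suc n]) (\<sigma> n) (\<sigma> (Suc n))" for n
    using assms(3) by (auto simp: igha_run_def simp del: upt_Suc)
  have inv: "queue_invariant P (\<sigma> n) \<and> coverage_invariant P (\<sigma> n)" for n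
  proof (induction n)
    case 0
    show ?case using init queue_invariant_initial coverage_invariant_initial by blast
  next
    case (Suc n)
    then show ?case
      using stay step queue_invariant_step coverage_invariant_step[OF assms(4)] by metis
  qed
  obtain n\<^sub>0 p\<^sub>0 where best\<^sub>0: "best (\<sigma> n\<^sub>0) = Some p\<^sub>0" using assms(7) by blast
  have "\<exists>N. terminated (\<sigma> N)"
  proof (rule ccontr)
    assume "\<nexists>N. terminated (\<sigma> N)"
    then have step: "igha_step P \<rho> (map \<sigma> [0..<Suc n]) (\<sigma> n) (\<sigma> (Suc n))" for n
      using step by blast
    have last: "last (map \<sigma> [0..<Suc n]) = \<sigma> n" for n by simp
    \<comment> \<open>Histories contain genuine steps only, so this relies on the run never
      terminating; validity of the rule speaks of histories.\<close>
    have hist: "history P \<rho> (map \<sigma> [0..<Suc n])" for n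
    proof (induction n)
      case 0
      show ?case using init history_init by simp
    next
      case (Suc n)
      have "history P \<rho> (map \<sigma> [0..<Suc n] @ [\<sigma> (Suc n)])"
        using Suc by (rule history_step) (use step[of n] last[of n] in metis)
      then show ?case by simp
    qed
    have progress: "progress_invariant P (\<sigma> n)" for n
    proof (induction n)
      case 0
      show ?case using init by (simp add: initial_state_def progress_invariant_def)
    next
      case (Suc n)
      show ?case
        using progress_invariant_step[OF assms(2) hist[of n], unfolded last] inv Suc step by blast
    qed
    \<comment> \<open>The cost of one fixed incumbent, so that \<open>F\<close> and the measure stay
      the same from \<open>n\<^sub>0\<close> on.\<close>
    define c where "c = path_cost P p\<^sub>0"
    define F where "F = {v \<in> pverts (graph P). g_value P v < c}"
    have cost: "opt_cost P (best (\<sigma> (n\<^sub>0 + k))) \<le> ereal c" for k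
    proof (induction k)
      case 0
      show ?case using best\<^sub>0 by (simp add: c_def)
    next
      case (Suc k)
      show ?case using best_cost_step[OF assms(1) step[of "n\<^sub>0 + k"]] Suc by simp
    qed
    have "finite F" unfolding F_def by (rule finite_cheap_vertices[OF assms(5,6)])
    then have "(remaining_work F (\<sigma> (n\<^sub>0 + Suc k)), remaining_work F (\<sigma> (n\<^sub>0 + k)))
        \<in> less_than <*lex*> less_than <*lex*> less_than" for k
      using remaining_work_step[OF _ progress step cost F_def] inv by simp
    moreover have "wf (less_than <*lex*> less_than <*lex*> less_than)" by auto
    ultimately show False
      unfolding wf_iff_no_infinite_down_chain by (elim notE, intro exI[of _ "\<lambda>k. remaining_work F (\<sigma> (n\<^sub>0 + k))"]) blast
  qed
  then obtain N where N: "terminated (\<sigma> N)" by blast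
  \<comment> \<open>The queue is empty, so only the first alternative of
    \<open>coverage_invariant\<close> is left.\<close>
  then have bound: "opt_cost P (best (\<sigma> N)) \<le> ereal (g_value P t)" if "t \<in> goals P" for t
    using inv[of N] that by (auto simp: coverage_invariant_def terminated_def)
  \<comment> \<open>\<open>p\<^sub>0\<close> supplies a goal, so \<open>bound\<close> makes the
    final cost finite and excludes \<open>None\<close>.\<close>
  have "solution P p\<^sub>0" using inv[of n\<^sub>0] best\<^sub>0 by (simp add: coverage_invariant_def)
  then obtain t where "t \<in> goals P" by (auto simp: solution_def)
  from bound[OF this] obtain p where p: "best (\<sigma> N) = Some p"
    by (cases "best (\<sigma> N)") auto
  have "path_cost P p \<le> path_cost P q" if "solution P q" for q
  proof -
    from that obtain t where "t \<in> goals P" "path P (root P) q t" by (auto simp: solution_def)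
    then show ?thesis using bound[of t] p tree_path_eqI[of q t] by (simp add: g_value_def)
  qed
  then have "best_solution P p"
    using inv[of N] p by (simp add: best_solution_def coverage_invariant_def)
  with N p show ?thesis by blast
qed

end
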